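(* Let $(X,d)$ and $(Y,\mu)$ be metric spaces, let $\mathcal B$ be a bornology on $X$, let $\Gamma$ be a directed set, let $I$ be a non-trivial ideal of $\Gamma$, let $((D_\gamma,u_\gamma))_{\gamma\in\Gamma}$ be a net in $\mathcal P[X,Y]$, and let $(D,u)\in\mathcal P[X,Y]$. Then the condition for every $B\in\mathcal B$ and $\epsilon>0$, $\{\gamma\in\Gamma:\text{ for every nonempty } B_1\subset B,\ u_\gamma(D_\gamma\cap B_1)\subset[u(D\cap B_1^\epsilon)]^\epsilon\}\in\mathbb F(I)$ holds if and only if the condition for every $B\in\mathcal B$ and $\epsilon>0$, $\left\{\gamma\in\Gamma:\ \sup_{z\in D_\gamma\cap B}\ \inf_{x\in B_d(z,\epsilon)\cap D}\mu(u(x),u_\gamma(z))<\epsilon\right\}\in\mathbb F(I)$ holds.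
   Context: A partial map from $(X,d)$ to $(Y,\mu)$ is a pair $(D,u)$ where $D$ is a nonempty closed subset of $X$ and $u:D\to Y$ is a function (not assumed continuous); $\mathcal P[X,Y]$ is the set of all partial maps. A bornology $\mathcal B$ on $X$ is a family of nonempty subsets of $X$ that covers $X$, is closed under finite unions, and is closed under taking nonempty subsets. $B_d(z,\epsilon)$ is the open $d$-ball of center $z$ and radius $\epsilon$. For a subset $A$ of a metric space and $\epsilon>0$, $A^\epsilon$ is the union of the open $\epsilon$-balls centered at points of $A$ (so $\emptyset^\epsilon=\emptyset$). A directed set is a nonempty set $\Gamma$ with a reflexive transitive relation $\ge$ such that any two elements have a common upper bound. An ideal $I$ of $\Gamma$ is a family of subsets of $\Gamma$ containing $\emptyset$ and closed under finite unions and under taking subsets; it is non-trivial if $I\ne\{\emptyset\}$ and $\Gamma\notin I$. $\mathbb F(I)=\{A\subset\Gamma:\Gamma\setminus A\in I\}$ is the associated filter. Suprema and infima are taken in $[0,+\infty]$, so $\inf\emptyset=+\infty$ and $\sup\emptyset=0$. *)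

theory Defs
  imports "HOL-Analysis.Analysis"
begin

text \<open>A partial map with domain \<open>D\<close> is encoded as a pair \<open>(D, u)\<close> with \<open>u\<close> a total HOL function;
  its values outside \<open>D\<close> carry no meaning.\<close>

definition partial_maps :: "('a::metric_space set \<times> ('a \<Rightarrow> 'b::metric_space)) set" where
  "partial_maps = {(D, u). D \<noteq> {} \<and> closed D}"

definition bornology :: "'a set set \<Rightarrow> bool" where
  "bornology \<B> \<longleftrightarrow>
     {} \<notin> \<B> \<and> \<Union>\<B> = UNIV \<and>
     (\<forall>A\<in>\<B>. \<forall>B\<in>\<B>. A \<union> B \<in> \<B>) \<and>
     (\<forall>B\<in>\<B>. \<forall>A. A \<noteq> {} \<and> A \<subseteq> B \<longrightarrow> A \<in> \<B>)"

definition enlargement :: "'a::metric_space set \<Rightarrow> real \<Rightarrow> 'a set" where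
  "enlargement A \<epsilon> = (\<Union>a\<in>A. ball a \<epsilon>)"

text \<open>In \<open>directed_set \<Gamma> ge\<close>, \<open>ge a b\<close> reads \<open>a \<ge> b\<close>.\<close>

definition directed_set :: "'g set \<Rightarrow> ('g \<Rightarrow> 'g \<Rightarrow> bool) \<Rightarrow> bool" where
  "directed_set \<Gamma> ge \<longleftrightarrow>
     \<Gamma> \<noteq> {} \<and> reflp_on \<Gamma> ge \<and> transp_on \<Gamma> ge \<and>
     (\<forall>a\<in>\<Gamma>. \<forall>b\<in>\<Gamma>. \<exists>c\<in>\<Gamma>. ge c a \<and> ge c b)"

definition set_ideal :: "'g set \<Rightarrow> 'g set set \<Rightarrow> bool" where
  "set_ideal \<Gamma> I \<longleftrightarrow>
     I \<subseteq> Pow \<Gamma> \<and> {} \<in> I \<and>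
     (\<forall>A\<in>I. \<forall>B\<in>I. A \<union> B \<in> I) \<and>
     (\<forall>B\<in>I. \<forall>A. A \<subseteq> B \<longrightarrow> A \<in> I)"

definition nontrivial_ideal :: "'g set \<Rightarrow> 'g set set \<Rightarrow> bool" where
  "nontrivial_ideal \<Gamma> I \<longleftrightarrow> set_ideal \<Gamma> I \<and> I \<noteq> {{}} \<and> \<Gamma> \<notin> I"

definition ideal_filter :: "'g set \<Rightarrow> 'g set set \<Rightarrow> 'g set set" where
  "ideal_filter \<Gamma> I = {A. A \<subseteq> \<Gamma> \<and> \<Gamma> - A \<in> I}"

end

theory Submission
  imports Defs
begin

text \<open>Up to a change of scale, both conditions express, index by index, the same approximation property: every point \<open>z\<close> of
  \<open>D\<^sub>\<gamma> \<inter> B\<close> has a point \<open>x \<in> D\<close> within \<open>\<epsilon>\<close> of it such that \<open>u x\<close> is within \<open>\<epsilon>\<close> of \<open>u\<^sub>\<gamma> z\<close>.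
  The inclusion for all nonempty \<open>B\<^sub>1 \<subseteq> B\<close> is equivalent to this property, since the enlargement of a
  set is the union of the balls around its points, so that only singletons \<open>B\<^sub>1\<close> matter
  (\<open>images_in_enlargement_iff\<close>). The property also follows from the bound on the supremum, because
  an infimum below \<open>\<epsilon>\<close> is undercut by some member (\<open>approximable_if_SUP_INF_less\<close>). In the other
  direction the supremum of numbers below \<open>\<epsilon>\<close> may equal \<open>\<epsilon>\<close>; but the property at scale
  \<open>\<epsilon>/2\<close> bounds it by \<open>\<epsilon>/2\<close> (\<open>SUP_INF_less_if_approximable_half\<close>). This loss of a
  factor is harmless, as both conditions quantify over all scales and \<open>ideal_filter \<Gamma> I\<close> is closed
  under supersets within \<open>\<Gamma>\<close>.\<close>

lemma ideal_filter_mono: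
  assumes "set_ideal \<Gamma> I" "A \<in> ideal_filter \<Gamma> I" "A \<subseteq> A'" "A' \<subseteq> \<Gamma>"
  shows "A' \<in> ideal_filter \<Gamma> I"
proof -
  have "\<Gamma> - A \<in> I" "\<Gamma> - A' \<subseteq> \<Gamma> - A"
    using assms(2,3) by (auto simp: ideal_filter_def)
  then have "\<Gamma> - A' \<in> I"
    using assms(1) unfolding set_ideal_def by blast
  then show ?thesis
    using assms(4) by (simp add: ideal_filter_def)
qed

text \<open>Testing the inclusion on \<open>B1 = {z}\<close> gives the pointwise property; conversely, each inclusion
  only concerns the points of \<open>B1\<close> one at a time, and \<open>ball z \<epsilon>\<close> is part of the enlargement of any
  \<open>B1\<close> containing \<open>z\<close>.\<close>

lemma images_in_enlargement_iff:
  fixes u :: "'a::metric_space \<Rightarrow> 'b::metric_space"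
  shows "(\<forall>B1. B1 \<noteq> {} \<and> B1 \<subseteq> B \<longrightarrow>
            v ` (E \<inter> B1) \<subseteq> enlargement (u ` (D \<inter> enlargement B1 \<epsilon>)) \<epsilon>)
         \<longleftrightarrow> (\<forall>z\<in>E \<inter> B. \<exists>x\<in>ball z \<epsilon> \<inter> D. dist (u x) (v z) < \<epsilon>)"
    (is "?L \<longleftrightarrow> ?R")
proof
  assume L: ?L
  show ?R
  proof
    fix z assume z: "z \<in> E \<inter> B"
    then have "v ` (E \<inter> {z}) \<subseteq> enlargement (u ` (D \<inter> enlargement {z} \<epsilon>)) \<epsilon>"
      using L by blast
    then show "\<exists>x\<in>ball z \<epsilon> \<inter> D. dist (u x) (v z) < \<epsilon>"
      using z by (auto simp: enlargement_def)
  qed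
next
  assume R: ?R
  show ?L
  proof (intro allI impI subsetI)
    fix B1 y assume B1: "B1 \<noteq> {} \<and> B1 \<subseteq> B" and "y \<in> v ` (E \<inter> B1)"
    then obtain z where z: "z \<in> E" "z \<in> B1" "y = v z"
      by blast
    then obtain x where x: "x \<in> ball z \<epsilon>" "x \<in> D" "dist (u x) (v z) < \<epsilon>"
      using R B1 by blast
    then have "x \<in> D \<inter> enlargement B1 \<epsilon>"
      using z(2) unfolding enlargement_def by blast
    moreover have "y \<in> ball (u x) \<epsilon>"
      using x(3) z(3) by simp
    ultimately show "y \<in> enlargement (u ` (D \<inter> enlargement B1 \<epsilon>)) \<epsilon>"
      unfolding enlargement_def[of "u ` _"] by blast
  qed
qed

text \<open>If no point of \<open>D\<close> lies in \<open>ball z \<epsilon>\<close>, the infimum at \<open>z\<close> is \<open>\<infinity>\<close>, so a supremum below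
  \<open>\<epsilon>\<close> also rules out this case.\<close>

lemma approximable_if_SUP_INF_less:
  fixes u :: "'a::metric_space \<Rightarrow> 'b::metric_space"
  assumes "(SUP z\<in>A. INF x\<in>ball z \<epsilon> \<inter> D. ennreal (dist (u x) (v z))) < ennreal \<epsilon>"
    and "z \<in> A"
  shows "\<exists>x\<in>ball z \<epsilon> \<inter> D. dist (u x) (v z) < \<epsilon>"
proof -
  have "(INF x\<in>ball z \<epsilon> \<inter> D. ennreal (dist (u x) (v z))) < ennreal \<epsilon>"
    using assms(2) by (rule le_less_trans[OF SUP_upper assms(1)])
  then show ?thesis
    by (auto simp: INF_less_iff ennreal_less_iff)
qed

text \<open>Halving the radius only shrinks the ball, so the points found at scale \<open>\<epsilon>/2\<close> still compete in the
  infimum over \<open>ball z \<epsilon>\<close>, while halving the bound on the values leaves room for the supremum to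
  stay strictly below \<open>\<epsilon>\<close>.\<close>

lemma SUP_INF_less_if_approximable_half:
  fixes u :: "'a::metric_space \<Rightarrow> 'b::metric_space"
  assumes "\<epsilon> > 0"
    and "\<forall>z\<in>A. \<exists>x\<in>ball z (\<epsilon>/2) \<inter> D. dist (u x) (v z) < \<epsilon>/2"
  shows "(SUP z\<in>A. INF x\<in>ball z \<epsilon> \<inter> D. ennreal (dist (u x) (v z))) < ennreal \<epsilon>"
proof -
  have "(INF x\<in>ball z \<epsilon> \<inter> D. ennreal (dist (u x) (v z))) \<le> ennreal (\<epsilon>/2)" if z: "z \<in> A" for z
  proof -
    obtain x where x: "x \<in> ball z (\<epsilon>/2) \<inter> D" "dist (u x) (v z) < \<epsilon>/2"
      using assms(2) z by blast
    then have "x \<in> ball z \<epsilon> \<inter> D"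
      using assms(1) by (simp add: mem_ball)
    then show ?thesis
      by (rule INF_lower2) (rule ennreal_leI[OF less_imp_le[OF x(2)]])
  qed
  then have "(SUP z\<in>A. INF x\<in>ball z \<epsilon> \<inter> D. ennreal (dist (u x) (v z))) \<le> ennreal (\<epsilon>/2)"
    by (rule SUP_least)
  also have "\<dots> < ennreal \<epsilon>"
    by (rule ennreal_lessI) (use assms(1) in auto)
  finally show ?thesis .
qed

theorem proposition3p2:
  fixes \<B> :: "'a::metric_space set set"
    and \<Gamma> :: "'g set" and ge :: "'g \<Rightarrow> 'g \<Rightarrow> bool" and I :: "'g set set"
    and Dn :: "'g \<Rightarrow> 'a set" and un :: "'g \<Rightarrow> 'a \<Rightarrow> 'b::metric_space"
    and D :: "'a set" and u :: "'a \<Rightarrow> 'b"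
  assumes "bornology \<B>"
    and "directed_set \<Gamma> ge"
    and "nontrivial_ideal \<Gamma> I"
    and "\<And>\<gamma>. \<gamma> \<in> \<Gamma> \<Longrightarrow> (Dn \<gamma>, un \<gamma>) \<in> partial_maps"
    and "(D, u) \<in> partial_maps"
  shows
    "(\<forall>B\<in>\<B>. \<forall>\<epsilon>::real. \<epsilon> > 0 \<longrightarrow>
        {\<gamma>\<in>\<Gamma>. \<forall>B1. B1 \<noteq> {} \<and> B1 \<subseteq> B \<longrightarrow>
           un \<gamma> ` (Dn \<gamma> \<inter> B1) \<subseteq> enlargement (u ` (D \<inter> enlargement B1 \<epsilon>)) \<epsilon>}
        \<in> ideal_filter \<Gamma> I)
     \<longleftrightarrow>
     (\<forall>B\<in>\<B>. \<forall>\<epsilon>::real. \<epsilon> > 0 \<longrightarrow>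
        {\<gamma>\<in>\<Gamma>. (SUP z\<in>Dn \<gamma> \<inter> B. INF x\<in>ball z \<epsilon> \<inter> D. ennreal (dist (u x) (un \<gamma> z)))
                 < ennreal \<epsilon>}
        \<in> ideal_filter \<Gamma> I)"
proof -
  have ideal: "set_ideal \<Gamma> I"
    using assms(3) by (simp add: nontrivial_ideal_def)
  define P where "P B \<epsilon> = {\<gamma>\<in>\<Gamma>. \<forall>z\<in>Dn \<gamma> \<inter> B. \<exists>x\<in>ball z \<epsilon> \<inter> D. dist (u x) (un \<gamma> z) < \<epsilon>}"
    for B and \<epsilon> :: real
  define S where "S B \<epsilon> = {\<gamma>\<in>\<Gamma>. (SUP z\<in>Dn \<gamma> \<inter> B. INF x\<in>ball z \<epsilon> \<inter> D.
      ennreal (dist (u x) (un \<gamma> z))) < ennreal \<epsilon>}" for B and \<epsilon> :: real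
  have SP: "S B \<epsilon> \<subseteq> P B \<epsilon>" for B \<epsilon>
    unfolding S_def P_def by (intro Collect_mono conj_mono imp_refl impI ballI)
      (rule approximable_if_SUP_INF_less)
  have PS: "P B (\<epsilon>/2) \<subseteq> S B \<epsilon>" if "\<epsilon> > 0" for B \<epsilon>
    unfolding S_def P_def by (intro Collect_mono conj_mono imp_refl impI)
      (rule SUP_INF_less_if_approximable_half[OF that])
  have "(\<forall>B\<in>\<B>. \<forall>\<epsilon>>0. P B \<epsilon> \<in> ideal_filter \<Gamma> I) \<longleftrightarrow> (\<forall>B\<in>\<B>. \<forall>\<epsilon>>0. S B \<epsilon> \<in> ideal_filter \<Gamma> I)"
  proof (intro iffI ballI allI impI)
    fix B and \<epsilon> :: real
    assume P: "\<forall>B\<in>\<B>. \<forall>\<epsilon>>0. P B \<epsilon> \<in> ideal_filter \<Gamma> I" and "B \<in> \<B>" "\<epsilon> > 0"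
    then have "P B (\<epsilon>/2) \<in> ideal_filter \<Gamma> I"
      by simp
    then show "S B \<epsilon> \<in> ideal_filter \<Gamma> I"
      by (rule ideal_filter_mono[OF ideal _ PS[OF \<open>\<epsilon> > 0\<close>]]) (auto simp: S_def)
  next
    fix B and \<epsilon> :: real
    assume "\<forall>B\<in>\<B>. \<forall>\<epsilon>>0. S B \<epsilon> \<in> ideal_filter \<Gamma> I" "B \<in> \<B>" "\<epsilon> > 0"
    then have "S B \<epsilon> \<in> ideal_filter \<Gamma> I"
      by simp
    then show "P B \<epsilon> \<in> ideal_filter \<Gamma> I"
      by (rule ideal_filter_mono[OF ideal _ SP]) (auto simp: P_def)
  qed
  then show ?thesis
    unfolding images_in_enlargement_iff P_def S_def .
qed

end
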